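(* Let $E$ be a separable Banach lattice, and let $f_j \colon \mathrm{SB}(E) \to E$, $j \in \omega$, be continuous functions such that for every $F \in \mathrm{SB}(E)$ one has $f_j(F) \in F$ for all $j\in\omega$ and $F = \overline{\{f_j(F) \colon j \in \omega\}}$. Fix a dense sequence $(g_k)_{k \in \omega}$ in $E$. Then $F \in \mathrm{Ideal}(E)$ if and only if $F \in \mathrm{SB}(E)$ and: (I1) $\lvert f_j(F) \rvert \in F$ for all $j \in \omega$; (I2) $\lvert g_k \rvert \wedge \lvert f_j(F) \rvert \in F$ for all $j, k \in \omega$. Moreover, $\mathrm{Ideal}(E)$ is a closed ($\boldsymbol{\Pi}^0_1$) subset of $\mathrm{SB}(E)$ and hence a Polish space.
   Context: All Banach spaces are real. For a Polish space $X$, $\mathcal{F}(X)$ denotes the family of non-empty closed subsets of $X$, and for $U\subseteq X$ open, $E^+(U)=\{F\in\mathcal F(X)\colon F\cap U\neq\emptyset\}$. A topology $\tau$ on $\mathcal{F}(X)$ is admissible if $(\mathcal F(X),\tau)$ is Polish and: (A1) $E^+(U)$ is $\tau$-open for every open $U\subseteq X$; (A2) there is a $\tau$-subbase each element of which is a countable union of sets of the form $E^+(U)\setminus E^+(V)$ with $U,V\subseteq X$ open. Condition (A3) says that $\{(x,F)\in X\times\mathcal F(X)\colon x\in F\}$ is closed in the product topology. For a separable Banach space $X$, $\mathrm{SB}(X)\subseteq\mathcal F(X)$ is the set of all closed linear subspaces of $X$ with the subspace topology, where $\mathcal{F}(X)$ carries an admissible topology satisfying (A1)--(A3). An example is the Wijsman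 topology, i.e. the coarsest topology making $F\mapsto d(x,F)$ continuous for all $x\in X$, where $d$ is a compatible metric on $X$. It is known (Godefroy--Saint-Raymond) that $\mathrm{SB}(X)$ is a $\boldsymbol{\Pi}^0_2$ subset of $\mathcal F(X)$, hence Polish, and that functions $f_j$ as in the statement exist. For a Banach lattice $E$ with order $\preceq$, $\lvert x\rvert = x\vee(-x)$. A closed linear subspace $F\subseteq E$ is a sublattice if $\lvert y\rvert\in F$ for every $y\in F$. A sublattice $J$ is an (order) ideal if whenever $x,y\in E$ satisfy $\lvert x\rvert\preceq\lvert y\rvert$ and $y\in J$, one has $x\in J$. $\mathrm{Ideal}(E)\subseteq\mathrm{SB}(E)$ is the set of all closed order ideals of $E$. *)

theory Defs
  imports "HOL-Analysis.Analysis" "HOL-Library.Lattice_Algebras"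
begin

text \<open>
  A (real) Banach lattice is a type of this class, ordered by \<open>\<le>\<close>, with join \<open>sup\<close> and meet
  \<open>inf\<close>; the class \<^class>\<open>lattice_ab_group_add_abs\<close> provides \<open>\<bar>x\<bar> = sup x (- x)\<close>.
  The type may carry only the zero vector.
\<close>

class banach_lattice = banach + ordered_real_vector + lattice_ab_group_add_abs +
  assumes norm_le_if_abs_le: "\<bar>x\<bar> \<le> \<bar>y\<bar> \<Longrightarrow> norm x \<le> norm y"

instance real :: banach_lattice
  by standard simp

definition Polish_topology :: "'a topology \<Rightarrow> bool" where
  "Polish_topology \<tau> \<longleftrightarrow> completely_metrizable_space \<tau> \<and> separable_space \<tau>"

definition nonempty_closed_sets :: "'a::topological_space set set" where
  "nonempty_closed_sets = {F. closed F \<and> F \<noteq> {}}"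

definition Eplus :: "'a::topological_space set \<Rightarrow> 'a set set" where
  "Eplus U = {F \<in> nonempty_closed_sets. F \<inter> U \<noteq> {}}"

text \<open>
  In the subbase condition, intersections are taken relative to the whole hyperspace, so the empty
  intersection is the hyperspace itself and the subbase need not cover it.
\<close>

definition admissible_topology :: "'a::topological_space set topology \<Rightarrow> bool" where
  "admissible_topology \<tau> \<longleftrightarrow>
     topspace \<tau> = nonempty_closed_sets \<and> Polish_topology \<tau> \<and>
     (\<forall>U. open U \<longrightarrow> openin \<tau> (Eplus U)) \<and>
     (\<exists>\<B>. (\<forall>B\<in>\<B>. (countable union_of
                     (\<lambda>D. \<exists>U V. open U \<and> open V \<and> D = Eplus U - Eplus V)) B) \<and>
          \<tau> = topology (arbitrary union_of
                 (finite intersection_of (\<lambda>B. B \<in> \<B>) relative_to nonempty_closed_sets)))"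

definition closed_membership :: "'a::topological_space set topology \<Rightarrow> bool" where
  "closed_membership \<tau> \<longleftrightarrow>
     closedin (prod_topology euclidean \<tau>) {(x, F). F \<in> nonempty_closed_sets \<and> x \<in> F}"

definition SB :: "'a::real_normed_vector set set" where
  "SB = {F \<in> nonempty_closed_sets. subspace F}"

definition SB_topology :: "'a::real_normed_vector set topology \<Rightarrow> 'a set topology" where
  "SB_topology \<tau> = subtopology \<tau> SB"

definition closed_sublattice :: "'a::banach_lattice set \<Rightarrow> bool" where
  "closed_sublattice F \<longleftrightarrow> F \<in> SB \<and> (\<forall>y\<in>F. \<bar>y\<bar> \<in> F)"

definition closed_order_ideal :: "'a::banach_lattice set \<Rightarrow> bool" where
  "closed_order_ideal J \<longleftrightarrow>
     closed_sublattice J \<and> (\<forall>x y. \<bar>x\<bar> \<le> \<bar>y\<bar> \<and> y \<in> J \<longrightarrow> x \<in> J)"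

definition Ideal :: "'a::banach_lattice set set" where
  "Ideal = {J. closed_order_ideal J}"

end

theory Submission
  imports Defs
begin

text \<open>
  The characterization rests on the fact that the lattice operations of a Banach lattice are
  continuous (\<open>tendsto_inf_banach_lattice\<close>, \<open>tendsto_abs_banach_lattice\<close>). Since
  \<open>{f j F}\<close> is dense in \<open>F\<close> and \<open>{g k}\<close> is dense in the whole space, (I1) and (I2) extend by
  continuity to \<open>\<bar>y\<bar> \<in> F\<close> and \<open>inf \<bar>z\<bar> \<bar>y\<bar> \<in> F\<close> for all \<open>y \<in> F\<close> and all \<open>z\<close>. If now
  \<open>\<bar>x\<bar> \<le> \<bar>y\<bar>\<close>, then the positive and the negative part \<open>z\<close> of \<open>x\<close> satisfy \<open>0 \<le> z \<le> \<bar>y\<bar>\<close>, so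
  \<open>z = inf \<bar>z\<bar> \<bar>y\<bar> \<in> F\<close>, and \<open>x\<close> is the difference of the two. Conversely an ideal contains
  \<open>inf \<bar>g k\<bar> \<bar>f j F\<bar>\<close> because this vector lies between \<open>0\<close> and \<open>\<bar>f j F\<bar>\<close>.

  Each of the countably many conditions (I1), (I2) has the form \<open>h F \<in> F\<close> with \<open>h\<close> continuous on
  the space of closed subspaces, and so defines a closed set: it is the preimage of the closed
  relation \<open>x \<in> F\<close> under \<open>F \<mapsto> (h F, F)\<close>. Hence the ideals form a closed set of subspaces.

  That this closed set is Polish follows once the closed subspaces form a \<open>G\<^sub>\<delta>\<close> in the hyperspace
  (\<open>gdelta_in_SB\<close>). The reason is that invariance of a closed set \<open>F\<close> under a continuous operation
  can be tested on a countable base: whenever the operation maps basic open sets into a basic open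
  set \<open>W\<close> and \<open>F\<close> meets those for its arguments, \<open>F\<close> must meet \<open>W\<close>. Each such test is the union of
  an open set and of closed sets of the hyperspace, hence a \<open>G\<^sub>\<delta>\<close>.
\<close>

section \<open>Separable metrizable and Polish spaces\<close>

lemma separable_metrizable_imp_second_countable:
  assumes met: "metrizable_space X" and sep: "separable_space X"
  shows "second_countable X"
proof -
  obtain M d where "Metric_space M d" and X: "X = Metric_space.mtopology M d"
    using met by (auto simp: metrizable_space_def)
  then interpret Metric_space M d by simp
  obtain C where C: "countable C" "C \<subseteq> M" "mtopology closure_of C = M"
    using sep by (auto simp: separable_space_def X)
  define B where "B = (\<lambda>(c, n). mball c (inverse (Suc n))) ` (C \<times> (UNIV :: nat set))"
  have "\<exists>V\<in>B. x \<in> V \<and> V \<subseteq> U" if U: "openin mtopology U" and x: "x \<in> U" for U x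
  proof -
    have xM: "x \<in> M"
      using U x openin_subset by fastforce
    obtain r where r: "r > 0" "mball x r \<subseteq> U"
      using U x by (auto simp: openin_mtopology)
    obtain n where n: "inverse (real (Suc n)) < r / 2"
      using reals_Archimedean[of "r / 2"] r by auto
    have "x \<in> mtopology closure_of C"
      using C xM by simp
    then have "\<forall>\<epsilon>>0. \<exists>c\<in>C. c \<in> mball x \<epsilon>"
      by (simp add: metric_closure_of)
    moreover have "0 < inverse (real (Suc n))"
      by simp
    ultimately obtain c where c: "c \<in> C" "c \<in> mball x (inverse (Suc n))"
      by blast
    have cM: "c \<in> M" and dcx: "d c x < inverse (Suc n)"
      using c by (auto simp: commute)
    have "mball c (inverse (Suc n)) \<subseteq> mball x r"
    proof
      fix y assume y: "y \<in> mball c (inverse (Suc n))"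
      then have "d x y \<le> d x c + d c y"
        using triangle xM cM by auto
      also have "\<dots> < r"
        using y dcx n commute[of x c] by auto
      finally show "y \<in> mball x r"
        using y xM by auto
    qed
    moreover have "x \<in> mball c (inverse (Suc n))"
      using xM cM dcx by simp
    ultimately show ?thesis
      using c r unfolding B_def by blast
  qed
  moreover have "countable B"
    unfolding B_def using C by blast
  moreover have "\<forall>V\<in>B. openin mtopology V"
    by (auto simp: B_def)
  ultimately show ?thesis
    unfolding second_countable_def X by blast
qed

text \<open>
  Separability alone is not inherited by arbitrary subspaces; second countability is.
\<close>

lemma Polish_topology_gdelta:
  assumes "Polish_topology X" "gdelta_in X S"
  shows "Polish_topology (subtopology X S)"
proof -
  have "second_countable X"
    using assms completely_metrizable_imp_metrizable_space separable_metrizable_imp_second_countable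
    by (auto simp: Polish_topology_def)
  then have "separable_space (subtopology X S)"
    by (intro second_countable_imp_separable_space second_countable_subtopology)
  then show ?thesis
    using assms completely_metrizable_space_gdelta_in by (auto simp: Polish_topology_def)
qed

section \<open>Invariant closed sets\<close>

text \<open>
  The operation carries a parameter \<open>p\<close> so that one instance covers scaling by all real numbers
  together with addition.
\<close>

lemma gdelta_in_invariant_closed_sets:
  fixes \<phi> :: "'p::topological_space \<times> 'a::topological_space \<times> 'a \<Rightarrow> 'a"
  assumes cont: "continuous_on UNIV \<phi>"
    and P: "second_countable (euclidean :: 'p topology)"
    and A: "second_countable (euclidean :: 'a topology)"
    and met: "metrizable_space \<tau>"
    and top: "topspace \<tau> = nonempty_closed_sets"
    and Eplus: "\<And>U. open U \<Longrightarrow> openin \<tau> (Eplus U)"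
  shows "gdelta_in \<tau> {F \<in> nonempty_closed_sets. \<forall>p. \<forall>x\<in>F. \<forall>y\<in>F. \<phi> (p, x, y) \<in> F}"
proof -
  obtain C :: "'p set set" where C: "countable C" "\<And>V. V \<in> C \<Longrightarrow> open V"
      "\<And>U x. open U \<Longrightarrow> x \<in> U \<Longrightarrow> \<exists>V\<in>C. x \<in> V \<and> V \<subseteq> U"
    using P unfolding second_countable_def open_openin[symmetric] by metis
  obtain B :: "'a set set" where B: "countable B" "\<And>V. V \<in> B \<Longrightarrow> open V"
      "\<And>U x. open U \<Longrightarrow> x \<in> U \<Longrightarrow> \<exists>V\<in>B. x \<in> V \<and> V \<subseteq> U"
    using A unfolding second_countable_def open_openin[symmetric] by metis
  define I where "I = {(U, V, V', W). U \<in> C \<and> V \<in> B \<and> V' \<in> B \<and> W \<in> B \<and>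
      U \<noteq> {} \<and> \<phi> ` (U \<times> V \<times> V') \<subseteq> W}"
  define S where "S = (\<lambda>(U :: 'p set, V :: 'a set, V' :: 'a set, W :: 'a set).
      (nonempty_closed_sets - Eplus V) \<union> (nonempty_closed_sets - Eplus V') \<union> Eplus W)"
  have "I \<subseteq> C \<times> B \<times> B \<times> B"
    by (auto simp: I_def)
  then have countI: "countable I"
    by (rule countable_subset) (intro countable_SIGMA C B)
  have gdelta_S: "gdelta_in \<tau> (S i)" if "i \<in> I" for i
  proof -
    obtain U V V' W where i: "i = (U, V, V', W)" and "open V" "open V'" "open W"
      using \<open>i \<in> I\<close> B by (auto simp: I_def)
    then have "closedin \<tau> (nonempty_closed_sets - Eplus V)"
      and "closedin \<tau> (nonempty_closed_sets - Eplus V')" and "openin \<tau> (Eplus W)"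
      using Eplus by (auto simp flip: top)
    then show ?thesis
      unfolding i S_def prod.case using met
      by (intro gdelta_in_Un) (blast intro: closed_imp_gdelta_in open_imp_gdelta_in)+
  qed
  have iff: "(\<forall>p. \<forall>x\<in>F. \<forall>y\<in>F. \<phi> (p, x, y) \<in> F) \<longleftrightarrow> (\<forall>i\<in>I. F \<in> S i)"
    if F: "F \<in> nonempty_closed_sets" for F
  proof
    assume inv: "\<forall>p. \<forall>x\<in>F. \<forall>y\<in>F. \<phi> (p, x, y) \<in> F"
    show "\<forall>i\<in>I. F \<in> S i"
    proof
      fix i assume "i \<in> I"
      then obtain U V V' W where i: "i = (U, V, V', W)" "\<phi> ` (U \<times> V \<times> V') \<subseteq> W" and "U \<noteq> {}"
        by (auto simp: I_def)
      then obtain p where "p \<in> U"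
        by blast
      show "F \<in> S i"
      proof (cases "F \<inter> V = {} \<or> F \<inter> V' = {}")
        case True
        then show ?thesis
          using F by (auto simp: S_def i Eplus_def)
      next
        case False
        then obtain x y where xy: "x \<in> F" "x \<in> V" "y \<in> F" "y \<in> V'"
          by blast
        then have "\<phi> (p, x, y) \<in> F \<inter> W"
          using inv i \<open>p \<in> U\<close> by blast
        then show ?thesis
          using F by (auto simp: S_def i Eplus_def)
      qed
    qed
  next
    assume tests: "\<forall>i\<in>I. F \<in> S i"
    show "\<forall>p. \<forall>x\<in>F. \<forall>y\<in>F. \<phi> (p, x, y) \<in> F"
    proof (intro allI ballI, rule ccontr)
      fix p x y assume x: "x \<in> F" and y: "y \<in> F" and notin: "\<phi> (p, x, y) \<notin> F"
      \<comment> \<open>By continuity, basic neighbourhoods of \<open>p\<close>, \<open>x\<close>, \<open>y\<close> are mapped into a basic \<open>W\<close> that misses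
        \<open>F\<close>, so the test belonging to them fails.\<close>
      have "open (- F)"
        using F by (simp add: nonempty_closed_sets_def open_Compl)
      then obtain W where W: "W \<in> B" "\<phi> (p, x, y) \<in> W" "W \<subseteq> - F"
        using B(3)[of "- F" "\<phi> (p, x, y)"] notin by auto
      have "open (\<phi> -` W)"
        using cont W B(2) by (simp add: continuous_on_open_vimage)
      then obtain U0 Z where UZ: "open U0" "open Z" "p \<in> U0" "(x, y) \<in> Z" "U0 \<times> Z \<subseteq> \<phi> -` W"
        using W open_prod_elim[of "\<phi> -` W" "(p, x, y)"] by (metis mem_Sigma_iff vimageI)
      then obtain V0 V0' where VV: "open V0" "open V0'" "x \<in> V0" "y \<in> V0'" "V0 \<times> V0' \<subseteq> Z"
        using open_prod_elim[of Z "(x, y)"] by (metis mem_Sigma_iff)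
      obtain U V V' where "U \<in> C" "p \<in> U" "U \<subseteq> U0" "V \<in> B" "x \<in> V" "V \<subseteq> V0"
          "V' \<in> B" "y \<in> V'" "V' \<subseteq> V0'"
        using C(3) B(3) UZ VV by metis
      moreover from this have "\<phi> ` (U \<times> V \<times> V') \<subseteq> W"
        using UZ VV by blast
      ultimately have "(U, V, V', W) \<in> I" and "x \<in> F \<inter> V" and "y \<in> F \<inter> V'"
        using W x y unfolding I_def by blast+
      then have "F \<inter> W \<noteq> {}"
        using tests F by (fastforce simp: S_def Eplus_def)
      then show False
        using W by blast
    qed
  qed
  \<comment> \<open>The whole hyperspace is added to the family so that the intersection is over a nonempty one.\<close>
  have "{F \<in> nonempty_closed_sets. \<forall>p. \<forall>x\<in>F. \<forall>y\<in>F. \<phi> (p, x, y) \<in> F} =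
      \<Inter> (insert nonempty_closed_sets (S ` I))"
    using iff by auto
  moreover have "gdelta_in \<tau> (\<Inter> (insert nonempty_closed_sets (S ` I)))"
    using countI gdelta_S by (intro gdelta_in_Inter) (auto simp flip: top)
  ultimately show ?thesis
    by simp
qed

text \<open>
  A single operation suffices: a nonempty set that is invariant under \<open>c *\<^sub>R x + y\<close> contains
  \<open>0 = (- 1) *\<^sub>R x + x\<close>, and then it is closed under scaling and addition.
\<close>

lemma gdelta_in_SB:
  fixes \<tau> :: "'a::real_normed_vector set topology"
  assumes "separable_space (euclidean :: 'a topology)"
    and "metrizable_space \<tau>" "topspace \<tau> = nonempty_closed_sets"
    and "\<And>U. open U \<Longrightarrow> openin \<tau> (Eplus U)"
  shows "gdelta_in \<tau> SB"
proof -
  have subspace_iff: "subspace F \<longleftrightarrow> (\<forall>c. \<forall>x\<in>F. \<forall>y\<in>F. c *\<^sub>R x + y \<in> F)"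
    if "F \<noteq> {}" for F :: "'a set"
  proof
    assume "subspace F"
    then show "\<forall>c. \<forall>x\<in>F. \<forall>y\<in>F. c *\<^sub>R x + y \<in> F"
      by (simp add: subspace_add subspace_scale)
  next
    assume inv: "\<forall>c. \<forall>x\<in>F. \<forall>y\<in>F. c *\<^sub>R x + y \<in> F"
    obtain x where "x \<in> F"
      using \<open>F \<noteq> {}\<close> by blast
    then have "(- 1) *\<^sub>R x + x \<in> F"
      using inv by blast
    then have zero: "0 \<in> F"
      by simp
    show "subspace F"
      unfolding subspace_def using zero inv by (metis add.right_neutral scaleR_one)
  qed
  have "second_countable (euclidean :: real topology)"
    unfolding second_countable_def open_openin[symmetric]
    by (metis ex_countable_basis topological_basisE topological_basis_open)
  moreover have "second_countable (euclidean :: 'a topology)"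
    using assms by (intro separable_metrizable_imp_second_countable metrizable_space_euclidean)
  moreover have "continuous_on UNIV (\<lambda>(c :: real, x :: 'a, y). c *\<^sub>R x + y)"
    by (auto simp: case_prod_unfold intro!: continuous_intros)
  ultimately have "gdelta_in \<tau> {F \<in> nonempty_closed_sets. \<forall>c. \<forall>x\<in>F. \<forall>y\<in>F.
      (\<lambda>(c :: real, x :: 'a, y). c *\<^sub>R x + y) (c, x, y) \<in> F}"
    by (intro gdelta_in_invariant_closed_sets assms)
  moreover have "{F \<in> nonempty_closed_sets. \<forall>c. \<forall>x\<in>F. \<forall>y\<in>F.
      (\<lambda>(c :: real, x :: 'a, y). c *\<^sub>R x + y) (c, x, y) \<in> F} = SB"
    using subspace_iff by (auto simp: SB_def nonempty_closed_sets_def)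
  ultimately show ?thesis
    by simp
qed

section \<open>Continuity of the lattice operations\<close>

lemma abs_inf_diff_le:
  fixes a b c d :: "'a::lattice_ab_group_add_abs"
  shows "\<bar>inf a b - inf c d\<bar> \<le> \<bar>a - c\<bar> + \<bar>b - d\<bar>"
proof -
  have le: "inf a b \<le> inf c d + (\<bar>a - c\<bar> + \<bar>b - d\<bar>)" for a b c d :: 'a
  proof -
    have "a \<le> c + (\<bar>a - c\<bar> + \<bar>b - d\<bar>)"
      using add_left_mono[OF add_increasing2[OF abs_ge_zero abs_ge_self], of c "a - c" "b - d"] by simp
    moreover have "b \<le> d + (\<bar>a - c\<bar> + \<bar>b - d\<bar>)"
      using add_left_mono[OF add_increasing[OF abs_ge_zero abs_ge_self], of d "b - d" "a - c"] by simp
    ultimately show ?thesis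
      by (simp add: add_inf_distrib_right le_infI1 le_infI2)
  qed
  show ?thesis
    using le[of a b c d] le[of c d a b]
    by (intro abs_leI) (simp_all only: minus_diff_eq diff_le_eq add.commute abs_minus_commute)
qed

lemma norm_abs_banach_lattice: "norm \<bar>x\<bar> = norm (x :: 'a::banach_lattice)"
  by (intro antisym norm_le_if_abs_le) simp_all

lemma tendsto_inf_banach_lattice:
  fixes a b :: "'a::banach_lattice"
  assumes "(u \<longlongrightarrow> a) F" "(v \<longlongrightarrow> b) F"
  shows "((\<lambda>x. inf (u x) (v x)) \<longlongrightarrow> inf a b) F"
proof -
  have bound: "norm (inf (u x) (v x) - inf a b) \<le> norm (u x - a) + norm (v x - b)" for x
  proof -
    have "norm (inf (u x) (v x) - inf a b) \<le> norm (\<bar>u x - a\<bar> + \<bar>v x - b\<bar>)"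
      by (intro norm_le_if_abs_le order_trans[OF abs_inf_diff_le]) simp
    also have "\<dots> \<le> norm (u x - a) + norm (v x - b)"
      using norm_triangle_ineq[of "\<bar>u x - a\<bar>" "\<bar>v x - b\<bar>"] by (simp add: norm_abs_banach_lattice)
    finally show ?thesis .
  qed
  have "((\<lambda>x. norm (u x - a) + norm (v x - b)) \<longlongrightarrow> 0) F"
    using assms by (intro tendsto_add_zero tendsto_norm_zero LIM_zero)
  then have "((\<lambda>x. inf (u x) (v x) - inf a b) \<longlongrightarrow> 0) F"
    by (rule Lim_null_comparison[rotated]) (rule always_eventually, rule allI, rule bound)
  then show ?thesis
    by (rule LIM_zero_cancel)
qed

lemma tendsto_abs_banach_lattice:
  fixes a :: "'a::banach_lattice"
  assumes "(u \<longlongrightarrow> a) F"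
  shows "((\<lambda>x. \<bar>u x\<bar>) \<longlongrightarrow> \<bar>a\<bar>) F"
proof -
  have abs_eq: "\<bar>x\<bar> = - inf x (- x)" for x :: 'a
    by (simp add: abs_lattice neg_inf_eq_sup sup_commute)
  show ?thesis
    unfolding abs_eq using assms by (intro tendsto_minus tendsto_inf_banach_lattice)
qed

lemma continuous_on_abs_banach_lattice:
  fixes u :: "'b::topological_space \<Rightarrow> 'a::banach_lattice"
  shows "continuous_on S u \<Longrightarrow> continuous_on S (\<lambda>x. \<bar>u x\<bar>)"
  unfolding continuous_on_def by (blast intro: tendsto_abs_banach_lattice)

lemma continuous_on_inf_banach_lattice:
  fixes u v :: "'b::topological_space \<Rightarrow> 'a::banach_lattice"
  shows "continuous_on S u \<Longrightarrow> continuous_on S v \<Longrightarrow> continuous_on S (\<lambda>x. inf (u x) (v x))"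
  unfolding continuous_on_def by (blast intro: tendsto_inf_banach_lattice)

section \<open>Ideals\<close>

text \<open>
  Truncation by \<open>\<bar>y\<bar>\<close> puts the positive and the negative part of any \<open>x\<close> with \<open>\<bar>x\<bar> \<le> \<bar>y\<bar>\<close> into \<open>F\<close>;
  applied to \<open>\<bar>x\<bar>\<close> itself it would give only \<open>\<bar>x\<bar> \<in> F\<close>.
\<close>

lemma mem_if_abs_le_and_inf_closed:
  fixes F :: "'a::banach_lattice set"
  assumes "subspace F" and trunc: "\<And>z. inf \<bar>z\<bar> \<bar>y\<bar> \<in> F" and le: "\<bar>x\<bar> \<le> \<bar>y\<bar>"
  shows "x \<in> F"
proof -
  have part: "sup u 0 \<in> F" if u: "u \<le> \<bar>y\<bar>" for u
  proof -
    have "\<bar>sup u 0\<bar> = sup u 0" and "sup u 0 \<le> \<bar>y\<bar>"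
      using u by (simp_all add: abs_of_nonneg)
    then show ?thesis
      using trunc[of "sup u 0"] by (simp add: inf_absorb1)
  qed
  have "x \<le> \<bar>y\<bar>" "- x \<le> \<bar>y\<bar>"
    using le abs_ge_self abs_ge_minus_self by (blast intro: order_trans)+
  then have "sup x 0 - sup (- x) 0 \<in> F"
    by (intro subspace_diff assms part)
  moreover have "sup x 0 - sup (- x) 0 = x"
    using add_eq_inf_sup[of x 0] neg_inf_eq_sup[of x 0] by (simp add: algebra_simps)
  ultimately show ?thesis
    by simp
qed

text \<open>
  For the direction from right to left, \<open>closure (G \<times> D)\<close> is the product of the closures, so a single
  extension by continuity treats both arguments of the meet.
\<close>

lemma mem_Ideal_iff_dense:
  fixes D G F :: "'a::banach_lattice set"
  assumes D: "D \<subseteq> F" "F \<subseteq> closure D" and G: "closure G = UNIV"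
  shows "F \<in> Ideal \<longleftrightarrow> F \<in> SB \<and> (\<forall>y\<in>D. \<bar>y\<bar> \<in> F) \<and> (\<forall>z\<in>G. \<forall>y\<in>D. inf \<bar>z\<bar> \<bar>y\<bar> \<in> F)"
proof
  assume "F \<in> Ideal"
  then have F: "F \<in> SB" "\<And>y. y \<in> F \<Longrightarrow> \<bar>y\<bar> \<in> F"
    and solid: "\<And>x y. \<bar>x\<bar> \<le> \<bar>y\<bar> \<Longrightarrow> y \<in> F \<Longrightarrow> x \<in> F"
    unfolding Ideal_def closed_order_ideal_def closed_sublattice_def by blast+
  have "inf \<bar>z\<bar> \<bar>y\<bar> \<in> F" if "y \<in> F" for z y
    using solid[of "inf \<bar>z\<bar> \<bar>y\<bar>" y] that by (simp add: abs_of_nonneg)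
  with F D show "F \<in> SB \<and> (\<forall>y\<in>D. \<bar>y\<bar> \<in> F) \<and> (\<forall>z\<in>G. \<forall>y\<in>D. inf \<bar>z\<bar> \<bar>y\<bar> \<in> F)"
    by blast
next
  assume *: "F \<in> SB \<and> (\<forall>y\<in>D. \<bar>y\<bar> \<in> F) \<and> (\<forall>z\<in>G. \<forall>y\<in>D. inf \<bar>z\<bar> \<bar>y\<bar> \<in> F)"
  then have "subspace F" and "closed F"
    by (auto simp: SB_def nonempty_closed_sets_def)
  have "abs ` closure D \<subseteq> F"
    using * \<open>closed F\<close>
    by (intro image_closure_subset) (auto intro!: continuous_on_abs_banach_lattice continuous_intros)
  then have abs_mem: "\<bar>y\<bar> \<in> F" if "y \<in> F" for y
    using D that by blast
  have "(\<lambda>(z, y). inf \<bar>z\<bar> \<bar>y\<bar>) ` closure (G \<times> D) \<subseteq> F"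
    using * \<open>closed F\<close>
    by (intro image_closure_subset)
      (auto simp: case_prod_unfold intro!: continuous_on_inf_banach_lattice
        continuous_on_abs_banach_lattice continuous_intros)
  then have inf_mem: "inf \<bar>z\<bar> \<bar>y\<bar> \<in> F" if "y \<in> F" for z y
    using D G that by (force simp: closure_Times)
  have "x \<in> F" if "\<bar>x\<bar> \<le> \<bar>y\<bar>" "y \<in> F" for x y
    using mem_if_abs_le_and_inf_closed[OF \<open>subspace F\<close> inf_mem] that by blast
  with * abs_mem show "F \<in> Ideal"
    unfolding Ideal_def closed_order_ideal_def closed_sublattice_def by blast
qed

text \<open>
  The set is the preimage of the closed membership relation under \<open>F \<mapsto> (h F, F)\<close>.
\<close>

lemma closedin_continuous_selection_mem:
  fixes \<tau> :: "'a::real_normed_vector set topology"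
  assumes mem: "closed_membership \<tau>" and top: "topspace \<tau> = nonempty_closed_sets"
    and h: "continuous_map (SB_topology \<tau>) euclidean h"
  shows "closedin (SB_topology \<tau>) {F \<in> SB. h F \<in> F}"
proof -
  have SB: "SB \<subseteq> (nonempty_closed_sets :: 'a set set)"
    by (auto simp: SB_def)
  then have "topspace (SB_topology \<tau>) = SB"
    using top by (auto simp: SB_topology_def)
  moreover have "continuous_map (SB_topology \<tau>) \<tau> (\<lambda>F. F)"
    by (simp add: SB_topology_def continuous_map_from_subtopology)
  then have "continuous_map (SB_topology \<tau>) (prod_topology euclidean \<tau>) (\<lambda>F. (h F, F))"
    using h by (simp add: continuous_map_pairedI)
  then have "closedin (SB_topology \<tau>)
      {F \<in> topspace (SB_topology \<tau>). (h F, F) \<in> {(x, F). F \<in> nonempty_closed_sets \<and> x \<in> F}}"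
    using mem unfolding closed_membership_def by (rule closedin_continuous_map_preimage)
  moreover have "{F \<in> SB. (h F, F) \<in> {(x, F). F \<in> nonempty_closed_sets \<and> x \<in> F}} =
      {F \<in> SB. h F \<in> F}"
    using SB by auto
  ultimately show ?thesis
    by simp
qed

theorem theorem4p4:
  fixes \<tau> :: "'e::banach_lattice set topology"
    and f :: "nat \<Rightarrow> 'e set \<Rightarrow> 'e"
    and g :: "nat \<Rightarrow> 'e"
  assumes "separable_space (euclidean :: 'e topology)"
    and "admissible_topology \<tau>"
    and "closed_membership \<tau>"
    and "\<And>j. continuous_map (SB_topology \<tau>) euclidean (f j)"
    and "\<And>F j. F \<in> SB \<Longrightarrow> f j F \<in> F"
    and "\<And>F. F \<in> SB \<Longrightarrow> F = closure {f j F | j. True}"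
    and "closure (range g) = UNIV"
  shows "(\<forall>F. F \<in> Ideal \<longleftrightarrow>
            F \<in> SB \<and> (\<forall>j. \<bar>f j F\<bar> \<in> F) \<and> (\<forall>j k. inf \<bar>g k\<bar> \<bar>f j F\<bar> \<in> F)) \<and>
         closedin (SB_topology \<tau>) Ideal \<and>
         Polish_topology (subtopology (SB_topology \<tau>) Ideal)"
proof -
  have top: "topspace \<tau> = nonempty_closed_sets" and Polish: "Polish_topology \<tau>"
    and Eplus: "\<And>U. open U \<Longrightarrow> openin \<tau> (Eplus U)"
    using assms(2) by (auto simp: admissible_topology_def)
  have char: "F \<in> Ideal \<longleftrightarrow>
      F \<in> SB \<and> (\<forall>j. \<bar>f j F\<bar> \<in> F) \<and> (\<forall>j k. inf \<bar>g k\<bar> \<bar>f j F\<bar> \<in> F)" for F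
  proof (cases "F \<in> SB")
    case True
    then have "{f j F | j. True} \<subseteq> F" "F \<subseteq> closure {f j F | j. True}"
      using assms(5) assms(6)[OF True] by auto
    from mem_Ideal_iff_dense[OF this assms(7)] show ?thesis
      by blast
  next
    case False
    then show ?thesis
      by (simp add: Ideal_def closed_order_ideal_def closed_sublattice_def)
  qed
  \<comment> \<open>Each condition has the form \<open>\<psi> (f j F) \<in> F\<close> for a continuous map \<open>\<psi>\<close> of the lattice.\<close>
  have cont: "continuous_map (SB_topology \<tau>) euclidean (\<lambda>F. \<psi> (f j F))"
    if "continuous_on UNIV \<psi>" for \<psi> :: "'e \<Rightarrow> 'e" and j
    using continuous_map_compose[OF assms(4)[of j], of euclidean \<psi>] that by (simp add: o_def)
  have I1: "closedin (SB_topology \<tau>) {F \<in> SB. \<bar>f j F\<bar> \<in> F}" for j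
    by (intro closedin_continuous_selection_mem assms(3) top cont
        continuous_on_abs_banach_lattice continuous_intros)
  have I2: "closedin (SB_topology \<tau>) {F \<in> SB. inf \<bar>g k\<bar> \<bar>f j F\<bar> \<in> F}" for j k
    by (intro closedin_continuous_selection_mem assms(3) top cont[of "\<lambda>y. inf \<bar>g k\<bar> \<bar>y\<bar>"]
        continuous_on_inf_banach_lattice continuous_on_abs_banach_lattice continuous_intros)
  have Ideal_eq: "Ideal = (\<Inter>j. {F \<in> SB. \<bar>f j F\<bar> \<in> F}) \<inter> (\<Inter>j. \<Inter>k. {F \<in> SB. inf \<bar>g k\<bar> \<bar>f j F\<bar> \<in> F})"
    using char by auto
  have closed: "closedin (SB_topology \<tau>) Ideal"
    unfolding Ideal_eq by (intro closedin_Int closedin_INT UNIV_not_empty I1 I2)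
  have met: "metrizable_space \<tau>"
    using Polish by (simp add: Polish_topology_def completely_metrizable_imp_metrizable_space)
  then have "gdelta_in \<tau> SB"
    by (intro gdelta_in_SB assms(1) top Eplus)
  then have "Polish_topology (SB_topology \<tau>)"
    unfolding SB_topology_def by (rule Polish_topology_gdelta[OF Polish])
  moreover have "gdelta_in (SB_topology \<tau>) Ideal"
    using closed met by (simp add: closed_imp_gdelta_in SB_topology_def metrizable_space_subtopology)
  ultimately have "Polish_topology (subtopology (SB_topology \<tau>) Ideal)"
    by (rule Polish_topology_gdelta)
  with char closed show ?thesis
    by blast
qed

end
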